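(* Let $\mathfrak{U}$ be a set and let $\mathcal{B}\subseteq\mathcal{P}(\mathfrak{U})\setminus\{\emptyset\}$ be a directed family with $\mathfrak{U}\in\mathcal{B}$. The following are equivalent: (1) $\mathcal{B}$ is unpackable. (2) If $A,B_1,\dots,B_n$ are balls with $A\subseteq\bigcup_{i=1}^n B_i$, then $A\subseteq B_i$ for some $i$. (3) Whenever $S=A_1\setminus(B_{1,1}\cup\dots\cup B_{1,m})=A_2\setminus(B_{2,1}\cup\dots\cup B_{2,n})$ is a swiss cheese (given by both presentations) and $B_{i,j}\cap B_{i,k}=\emptyset$ for $i\in\{1,2\}$ and $j\neq k$, then $A_1=A_2$ and $\{B_{1,1},\dots,B_{1,m}\}=\{B_{2,1},\dots,B_{2,n}\}$. (4) Every constructible set $X\subseteq\mathfrak{U}$ admits a unique swiss cheese decomposition.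
   Context: A family $\mathcal{B}\subseteq\mathcal{P}(\mathfrak{U})\setminus\{\emptyset\}$ is directed if for all $B_0,B_1\in\mathcal{B}$ one has $B_0\subseteq B_1$, $B_1\subseteq B_0$, or $B_0\cap B_1=\emptyset$. Members of $\mathcal{B}$ are called balls; a constructible set is a finite boolean combination of balls. $\mathcal{B}$ is unpackable if no ball is a finite union of balls properly contained in it. A swiss cheese is a set of the form $S=A\setminus(B_1\cup\dots\cup B_n)$ where $A$ is a ball and $B_1,\dots,B_n\subsetneq A$ are balls properly contained in $A$ ($n=0$ allowed), with $B_i\not\subseteq B_j$ for $i\neq j$; $A$ is a wheel and the $B_i$ are holes (relative to the presentation). A swiss cheese decomposition of $X$ is a finite collection of swiss cheeses $S_1,\dots,S_n$ ($n=0$ allowed) such that (i) $S_i\cap S_j=\emptyset$ for $i\neq j$, (ii) no wheel of any $S_i$ equals a hole of any $S_j$, and (iii) $X=S_1\cup\dots\cup S_n$. *)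

theory Defs
  imports Main
begin

definition directed_family :: "'a set set \<Rightarrow> bool" where
  "directed_family \<B> \<longleftrightarrow>
     (\<forall>B0\<in>\<B>. \<forall>B1\<in>\<B>. B0 \<subseteq> B1 \<or> B1 \<subseteq> B0 \<or> B0 \<inter> B1 = {})"

definition unpackable :: "'a set set \<Rightarrow> bool" where
  "unpackable \<B> \<longleftrightarrow>
     \<not> (\<exists>A\<in>\<B>. \<exists>F. finite F \<and> F \<subseteq> \<B> \<and> (\<forall>B\<in>F. B \<subset> A) \<and> A = \<Union>F)"

inductive_set constructible :: "'a set \<Rightarrow> 'a set set \<Rightarrow> 'a set set"
  for U :: "'a set" and \<B> :: "'a set set" where
  ball: "B \<in> \<B> \<Longrightarrow> B \<in> constructible U \<B>"
| compl: "X \<in> constructible U \<B> \<Longrightarrow> U - X \<in> constructible U \<B>"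
| union: "X \<in> constructible U \<B> \<Longrightarrow> Y \<in> constructible U \<B> \<Longrightarrow> X \<union> Y \<in> constructible U \<B>"
| inter: "X \<in> constructible U \<B> \<Longrightarrow> Y \<in> constructible U \<B> \<Longrightarrow> X \<inter> Y \<in> constructible U \<B>"

text \<open>Wheels and holes depend on how a swiss cheese is presented, so a swiss cheese is
  represented by its presentation: the pair \<open>(A, H)\<close> of the wheel and the set of holes. Since
  holes with different indices are incomparable, a set of holes carries the same information
  as an indexed list, up to order.\<close>

type_synonym 'a cheese = "'a set \<times> 'a set set"

definition wheel :: "'a cheese \<Rightarrow> 'a set" where
  "wheel S = fst S"

definition holes :: "'a cheese \<Rightarrow> 'a set set" where
  "holes S = snd S"

definition cheese_set :: "'a cheese \<Rightarrow> 'a set" where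
  "cheese_set S = wheel S - \<Union>(holes S)"

definition swiss_cheese :: "'a set set \<Rightarrow> 'a cheese \<Rightarrow> bool" where
  "swiss_cheese \<B> S \<longleftrightarrow>
     wheel S \<in> \<B> \<and> finite (holes S) \<and> holes S \<subseteq> \<B> \<and>
     (\<forall>B\<in>holes S. B \<subset> wheel S) \<and>
     (\<forall>B\<in>holes S. \<forall>C\<in>holes S. B \<noteq> C \<longrightarrow> \<not> B \<subseteq> C)"

definition swiss_cheese_decomposition :: "'a set set \<Rightarrow> 'a set \<Rightarrow> 'a cheese set \<Rightarrow> bool" where
  "swiss_cheese_decomposition \<B> X D \<longleftrightarrow>
     finite D \<and> (\<forall>S\<in>D. swiss_cheese \<B> S) \<and>
     (\<forall>S\<in>D. \<forall>T\<in>D. S \<noteq> T \<longrightarrow> cheese_set S \<inter> cheese_set T = {}) \<and>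
     (\<forall>S\<in>D. \<forall>T\<in>D. wheel S \<notin> holes T) \<and>
     X = (\<Union>S\<in>D. cheese_set S)"

end

theory Submission
  imports Defs
begin

text \<open>Unpackability gives, for every finite set \<open>T\<close> of balls and every \<open>t \<in> T\<close>, a generic point
  of \<open>t\<close>: a point whose only members of \<open>T\<close> are those containing \<open>t\<close>. Given two decompositions
  of \<open>X\<close>, let \<open>T\<close> consist of all their wheels and holes. The wheels are then the \<open>t \<in> T\<close> whose
  generic point lies in \<open>X\<close> while that of the next larger member of \<open>T\<close> (if any) does not; the
  holes are the \<open>t\<close> for which it is the other way round; and each hole belongs to the smallest
  wheel above it. So the decomposition can be read off from \<open>X\<close> and \<open>T\<close>.

  For existence, \<open>X\<close> is a disjoint union of atoms of a finite set of balls, which are swiss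
  cheeses, and a cheese whose wheel is a hole of another one can be glued into it, so a disjoint
  collection of least cardinality satisfies condition (ii).

  Conversely, a packing of \<open>A\<close> by maximal, hence disjoint, proper subballs yields two
  decompositions of \<open>A\<close>, and two presentations of each of these subballs.\<close>

section \<open>Directed families of balls and finite covers\<close>

locale ball_family =
  fixes \<B> :: "'a set set"
  assumes directed: "directed_family \<B>"
    and nonempty: "{} \<notin> \<B>"
begin

lemma subset_or_subset_or_disjoint:
  assumes "A \<in> \<B>" "B \<in> \<B>"
  shows "A \<subseteq> B \<or> B \<subseteq> A \<or> A \<inter> B = {}"
  using directed assms unfolding directed_family_def by blast

lemma comparable_if_common_point:
  assumes "A \<in> \<B>" "B \<in> \<B>" "x \<in> A" "x \<in> B"
  shows "A \<subseteq> B \<or> B \<subseteq> A"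
  using subset_or_subset_or_disjoint assms by blast

text \<open>Balls are nonempty, so any point of \<open>C\<close> is a common point of
  \<open>A\<close> and \<open>B\<close>.\<close>

lemma comparable_if_common_subball:
  assumes "A \<in> \<B>" "B \<in> \<B>" "C \<in> \<B>" "C \<subseteq> A" "C \<subseteq> B"
  shows "A \<subseteq> B \<or> B \<subseteq> A"
proof -
  obtain x where "x \<in> C" using nonempty assms by fastforce
  then show ?thesis using comparable_if_common_point assms by blast
qed

text \<open>In a finite family every member lies in a maximal one, so the maximal members have the
  same union. Distinct maximal members are incomparable, hence disjoint by directedness.\<close>

lemma maximal_balls:
  assumes "finite F" "F \<subseteq> \<B>"
  obtains M where "M \<subseteq> F" "\<Union>M = \<Union>F" "pairwise disjnt M"
    "\<forall>B\<in>M. \<forall>C\<in>M. B \<noteq> C \<longrightarrow> \<not> B \<subseteq> C"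
proof
  let ?M = "{B\<in>F. \<forall>C\<in>F. B \<subseteq> C \<longrightarrow> C = B}"
  show "?M \<subseteq> F" by blast
  show "\<Union>?M = \<Union>F"
  proof
    show "\<Union>F \<subseteq> \<Union>?M"
    proof
      fix x assume "x \<in> \<Union>F"
      then obtain B where B: "B \<in> F" "x \<in> B" by blast
      then obtain M where "M \<in> F" "B \<subseteq> M" "\<forall>C\<in>F. M \<subseteq> C \<longrightarrow> C = M"
        using finite_has_maximal2[OF assms(1)] by metis
      then show "x \<in> \<Union>?M" using B by blast
    qed
  qed blast
  show "pairwise disjnt ?M"
    unfolding pairwise_def disjnt_def
    using subset_or_subset_or_disjoint assms(2) by (smt (verit) mem_Collect_eq subset_iff)
  show "\<forall>B\<in>?M. \<forall>C\<in>?M. B \<noteq> C \<longrightarrow> \<not> B \<subseteq> C" by blast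
qed

lemma unpackable_iff_cover:
  "unpackable \<B> \<longleftrightarrow>
    (\<forall>A\<in>\<B>. \<forall>F. finite F \<and> F \<subseteq> \<B> \<and> A \<subseteq> \<Union>F \<longrightarrow> (\<exists>B\<in>F. A \<subseteq> B))" (is "_ \<longleftrightarrow> ?cover")
proof
  assume unp: "unpackable \<B>"
  show ?cover
  proof (intro ballI allI impI, rule ccontr)
    fix A F assume A: "A \<in> \<B>" and F: "finite F \<and> F \<subseteq> \<B> \<and> A \<subseteq> \<Union>F"
      and no: "\<not> (\<exists>B\<in>F. A \<subseteq> B)"
    let ?G = "{B\<in>F. A \<inter> B \<noteq> {}}"
    have sub: "\<forall>B\<in>?G. B \<subset> A"
    proof
      fix B assume "B \<in> ?G"
      then show "B \<subset> A" using subset_or_subset_or_disjoint[of A B] A F no by blast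
    qed
    then have "A = \<Union>?G" using F by blast
    moreover have "finite ?G" "?G \<subseteq> \<B>" using F by auto
    ultimately show False using unp A sub unfolding unpackable_def by blast
  qed
next
  assume ?cover
  then show "unpackable \<B>" unfolding unpackable_def by (metis order_refl psubsetE)
qed

section \<open>Failure of uniqueness for packable families\<close>

lemma packing_by_disjoint_balls:
  assumes "\<not> unpackable \<B>"
  obtains A M where "A \<in> \<B>" "finite M" "M \<subseteq> \<B>" "\<forall>B\<in>M. B \<subset> A" "A = \<Union>M" "pairwise disjnt M"
    "\<forall>B\<in>M. \<forall>C\<in>M. B \<noteq> C \<longrightarrow> \<not> B \<subseteq> C"
proof -
  obtain A F where AF: "A \<in> \<B>" "finite F" "F \<subseteq> \<B>" "\<forall>B\<in>F. B \<subset> A" "A = \<Union>F"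
    using assms unfolding unpackable_def by blast
  obtain M where M: "M \<subseteq> F" "\<Union>M = \<Union>F" "pairwise disjnt M"
    "\<forall>B\<in>M. \<forall>C\<in>M. B \<noteq> C \<longrightarrow> \<not> B \<subseteq> C"
    using maximal_balls[OF AF(2,3)] .
  show ?thesis
  proof (rule that)
    show "finite M" using AF(2) M(1) finite_subset by blast
    show "M \<subseteq> \<B>" using AF(3) M(1) by blast
    show "\<forall>B\<in>M. B \<subset> A" using AF(4) M(1) by blast
    show "A = \<Union>M" using AF(5) M(2) by simp
  qed (use AF M in auto)
qed

text \<open>Single out one ball \<open>B\<close> of a disjoint packing of \<open>A\<close>: it is a
  cheese without holes, and also what is left of \<open>A\<close> when the other balls of the
  packing are removed. The wheels \<open>B\<close> and \<open>A\<close> differ.\<close>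

lemma two_presentations_if_packable:
  assumes "\<not> unpackable \<B>"
  obtains A1 H1 A2 H2 where "swiss_cheese \<B> (A1, H1)" "swiss_cheese \<B> (A2, H2)"
    "cheese_set (A1, H1) = cheese_set (A2, H2)" "pairwise disjnt H1" "pairwise disjnt H2"
    "A1 \<noteq> A2"
proof -
  obtain A M where M: "A \<in> \<B>" "finite M" "M \<subseteq> \<B>" "\<forall>B\<in>M. B \<subset> A" "A = \<Union>M" "pairwise disjnt M"
    "\<forall>B\<in>M. \<forall>C\<in>M. B \<noteq> C \<longrightarrow> \<not> B \<subseteq> C"
    using packing_by_disjoint_balls[OF assms] .
  have "A \<noteq> {}" using M(1) nonempty by blast
  then obtain B where B: "B \<in> M" using M(5) by blast
  have "\<forall>C\<in>M - {B}. B \<inter> C = {}"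
    using M(6) B unfolding pairwise_def disjnt_def by blast
  then have "B = \<Union>M - \<Union>(M - {B})" using B by auto
  then have "B = A - \<Union>(M - {B})" using M(5) by simp
  moreover have "pairwise disjnt (M - {B})" using M(6) by (rule pairwise_subset) blast
  ultimately show ?thesis
    using M B
    by (intro that[of B "{}" A "M - {B}"])
      (auto simp: swiss_cheese_def wheel_def holes_def cheese_set_def pairwise_def)
qed

text \<open>Either \<open>A\<close> alone or the balls of a disjoint packing, all taken without
  holes, so that condition (ii) is vacuous.\<close>

lemma two_decompositions_if_packable:
  assumes "\<not> unpackable \<B>"
  obtains A D E where "A \<in> \<B>" "swiss_cheese_decomposition \<B> A D"
    "swiss_cheese_decomposition \<B> A E" "D \<noteq> E"
proof -
  obtain A M where M: "A \<in> \<B>" "finite M" "M \<subseteq> \<B>" "\<forall>B\<in>M. B \<subset> A" "A = \<Union>M" "pairwise disjnt M"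
    using packing_by_disjoint_balls[OF assms] by metis
  show ?thesis
  proof (rule that)
    show "swiss_cheese_decomposition \<B> A {(A, {})}"
      using M(1) by (auto simp: swiss_cheese_decomposition_def swiss_cheese_def wheel_def
          holes_def cheese_set_def)
    show "swiss_cheese_decomposition \<B> A ((\<lambda>B. (B, {})) ` M)"
      using M by (auto simp: swiss_cheese_decomposition_def swiss_cheese_def wheel_def
          holes_def cheese_set_def pairwise_def disjnt_def)
    show "{(A, {})} \<noteq> (\<lambda>B. (B, {})) ` M" using M(4) by auto
  qed fact
qed

section \<open>Next larger balls and generic points\<close>

definition parent :: "'a set set \<Rightarrow> 'a set \<Rightarrow> 'a set \<Rightarrow> bool" where
  "parent T p t \<longleftrightarrow> p \<in> T \<and> t \<subset> p \<and> (\<forall>q\<in>T. t \<subset> q \<longrightarrow> p \<subseteq> q)"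

text \<open>The members of \<open>T\<close> strictly above \<open>t\<close> share the subball
  \<open>t\<close>, hence form a chain, and a minimal one is least.\<close>

lemma parent_exists:
  assumes "finite T" "T \<subseteq> \<B>" "t \<in> \<B>" "q \<in> T" "t \<subset> q"
  obtains p where "parent T p t"
proof -
  let ?Q = "{q\<in>T. t \<subset> q}"
  have "finite ?Q" "?Q \<noteq> {}" using assms by auto
  then obtain p where p: "p \<in> ?Q" "\<forall>q\<in>?Q. q \<subseteq> p \<longrightarrow> q = p"
    using finite_has_minimal[of ?Q] by metis
  have "p \<subseteq> q" if "q \<in> T" "t \<subset> q" for q
  proof -
    have "p \<in> \<B>" "q \<in> \<B>" "t \<subseteq> p" "t \<subseteq> q" using that p(1) assms(2) by auto
    then have "p \<subseteq> q \<or> q \<subseteq> p" using comparable_if_common_subball assms(3) by metis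
    then show ?thesis using p(2) that by auto
  qed
  then have "parent T p t" using p(1) unfolding parent_def by simp
  then show ?thesis by (rule that)
qed

text \<open>By unpackability the members of \<open>T\<close> strictly inside \<open>t\<close> do not
  exhaust \<open>t\<close>. A remaining point works: any \<open>s\<close> in \<open>T\<close>
  through it is comparable with \<open>t\<close> but not strictly smaller.\<close>

lemma generic_point_exists:
  assumes "unpackable \<B>" "finite T" "T \<subseteq> \<B>" "t \<in> \<B>"
  shows "\<exists>x. \<forall>s\<in>T. x \<in> s \<longleftrightarrow> t \<subseteq> s"
proof -
  let ?F = "{s\<in>T. s \<subset> t}"
  have "finite ?F" "?F \<subseteq> \<B>" "\<forall>s\<in>?F. s \<subset> t" using assms(2,3) by auto
  then have "t \<noteq> \<Union>?F" using assms(1,4) unfolding unpackable_def by metis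
  then obtain x where x: "x \<in> t" "x \<notin> \<Union>?F" by blast
  have "x \<in> s \<longleftrightarrow> t \<subseteq> s" if "s \<in> T" for s
  proof
    assume "x \<in> s"
    then have "s \<subseteq> t \<or> t \<subseteq> s" using comparable_if_common_point x(1) that assms(3,4) by blast
    then show "t \<subseteq> s" using x(2) \<open>x \<in> s\<close> that by auto
  qed (use x(1) in auto)
  then show ?thesis by blast
qed

end

section \<open>Reading off a decomposition from generic points\<close>

locale decomposition_with_generic_points = ball_family \<B> for \<B> :: "'a set set" +
  fixes T :: "'a set set" and g :: "'a set \<Rightarrow> 'a" and X :: "'a set" and D :: "'a cheese set"
  assumes T: "finite T" "T \<subseteq> \<B>"
    and generic: "\<And>t s. t \<in> T \<Longrightarrow> s \<in> T \<Longrightarrow> g t \<in> s \<longleftrightarrow> t \<subseteq> s"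
    and decomposition: "swiss_cheese_decomposition \<B> X D"
    and wheels_in: "\<And>S. S \<in> D \<Longrightarrow> wheel S \<in> T"
    and holes_in: "\<And>S. S \<in> D \<Longrightarrow> holes S \<subseteq> T"
begin

lemma cheese:
  assumes "S \<in> D"
  shows "\<And>h. h \<in> holes S \<Longrightarrow> h \<subset> wheel S"
    and "\<And>h k. h \<in> holes S \<Longrightarrow> k \<in> holes S \<Longrightarrow> h \<subseteq> k \<Longrightarrow> h = k"
  using decomposition assms unfolding swiss_cheese_decomposition_def swiss_cheese_def by blast+

lemma wheel_not_hole:
  assumes "S \<in> D" "S' \<in> D"
  shows "wheel S \<notin> holes S'"
  using decomposition assms unfolding swiss_cheese_decomposition_def by blast

lemma generic_in_cheese_iff:
  assumes "S \<in> D" "t \<in> T"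
  shows "g t \<in> cheese_set S \<longleftrightarrow> t \<subseteq> wheel S \<and> (\<forall>h\<in>holes S. \<not> t \<subseteq> h)"
  using generic[OF assms(2)] wheels_in[OF assms(1)] holes_in[OF assms(1)]
  unfolding cheese_set_def by blast

lemma generic_in_iff: "g t \<in> X \<longleftrightarrow> (\<exists>S\<in>D. g t \<in> cheese_set S)"
  using decomposition unfolding swiss_cheese_decomposition_def by blast

lemma same_cheese:
  assumes "S \<in> D" "S' \<in> D" "x \<in> cheese_set S" "x \<in> cheese_set S'"
  shows "S = S'"
  using decomposition assms unfolding swiss_cheese_decomposition_def by blast

lemma generic_wheel_in_cheese:
  assumes "S \<in> D"
  shows "g (wheel S) \<in> cheese_set S"
  using generic_in_cheese_iff[OF assms wheels_in[OF assms]] cheese(1)[OF assms] by blast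

text \<open>The wheel lies in \<open>T\<close> strictly above \<open>t\<close>, so it contains
  \<open>p\<close>; a hole containing \<open>p\<close> would strictly contain \<open>t\<close>. The
  last hypothesis excludes only strict inclusion, so that \<open>t\<close> may itself be a hole of
  \<open>S\<close>, as in \<open>hole_iff\<close>.\<close>

lemma parent_generic_in_cheese:
  assumes "S \<in> D" "t \<in> T" "parent T p t" "t \<subset> wheel S" "\<forall>h\<in>holes S. \<not> t \<subset> h"
  shows "g p \<in> cheese_set S"
proof -
  have "p \<in> T" "t \<subset> p" "p \<subseteq> wheel S"
    using assms(3,4) wheels_in[OF assms(1)] unfolding parent_def by simp_all
  then show ?thesis
    using generic_in_cheese_iff[OF assms(1)] assms(5) by (metis psubset_subset_trans)
qed

text \<open>If \<open>t\<close> is the wheel of \<open>S\<close> and \<open>g p\<close> lay in a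
  cheese \<open>S'\<close>, then \<open>g t\<close> would lie in \<open>S'\<close> too, forcing
  \<open>S' = S\<close> although \<open>p\<close> exceeds the wheel of \<open>S\<close>. Conversely,
  if \<open>g t\<close> lies in \<open>S\<close> but \<open>t\<close> is strictly inside its wheel,
  the generic point of the parent also lies in \<open>S\<close>.\<close>

lemma wheel_iff:
  assumes t: "t \<in> T"
  shows "t \<in> wheel ` D \<longleftrightarrow> g t \<in> X \<and> (\<forall>p. parent T p t \<longrightarrow> g p \<notin> X)"
proof
  assume "t \<in> wheel ` D"
  then obtain S where S: "S \<in> D" "t = wheel S" by blast
  have "g p \<notin> X" if p: "parent T p t" for p
  proof
    assume "g p \<in> X"
    then obtain S' where S': "S' \<in> D" "g p \<in> cheese_set S'" using generic_in_iff by blast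
    have tp: "p \<in> T" "t \<subset> p" using p unfolding parent_def by simp_all
    then have p_in: "p \<subseteq> wheel S'" "\<forall>h\<in>holes S'. \<not> p \<subseteq> h"
      using generic_in_cheese_iff S' by blast+
    have "\<not> t \<subseteq> h" if "h \<in> holes S'" for h
    proof
      assume "t \<subseteq> h"
      \<comment> \<open>Condition (ii) enters here: the wheel \<open>t\<close> is not a hole, so
        \<open>h\<close> is strictly above \<open>t\<close> and must contain its parent.\<close>
      moreover have "t \<noteq> h" using that wheel_not_hole[OF S(1) S'(1)] S(2) by blast
      moreover have "h \<in> T" using that holes_in[OF S'(1)] by blast
      ultimately have "p \<subseteq> h" using p unfolding parent_def by simp
      then show False using p_in(2) that by blast
    qed
    then have "g t \<in> cheese_set S'" using generic_in_cheese_iff S'(1) t tp p_in by blast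
    then have "S = S'" using same_cheese S S' generic_wheel_in_cheese by blast
    then show False using p_in tp S by blast
  qed
  then show "g t \<in> X \<and> (\<forall>p. parent T p t \<longrightarrow> g p \<notin> X)"
    using generic_in_iff generic_wheel_in_cheese S by blast
next
  assume r: "g t \<in> X \<and> (\<forall>p. parent T p t \<longrightarrow> g p \<notin> X)"
  then obtain S where S: "S \<in> D" "g t \<in> cheese_set S" using generic_in_iff by blast
  then have t_in: "t \<subseteq> wheel S" "\<forall>h\<in>holes S. \<not> t \<subseteq> h"
    using generic_in_cheese_iff t by blast+
  have "t = wheel S"
  proof (rule ccontr)
    assume "t \<noteq> wheel S"
    then have "t \<subset> wheel S" using t_in by blast
    moreover obtain p where "parent T p t"
      using parent_exists[OF T] calculation t T wheels_in[OF S(1)] by blast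
    ultimately show False
      using parent_generic_in_cheese[OF S(1) t] t_in generic_in_iff S(1) r by blast
  qed
  then show "t \<in> wheel ` D" using S by blast
qed

text \<open>For a hole \<open>t\<close> of \<open>S\<close>, \<open>g p\<close> lies in
  \<open>S\<close>. If \<open>g t\<close> lay in some \<open>S'\<close>, then by condition (ii)
  \<open>t\<close> would be strictly inside the wheel of \<open>S'\<close>, so \<open>g p\<close>
  would lie in \<open>S'\<close> as well; but then \<open>S' = S\<close>, which omits
  \<open>t\<close>. Conversely, only a hole of the cheese around \<open>g p\<close> can exclude
  \<open>g t\<close>, and a hole strictly above \<open>t\<close> would swallow
  \<open>p\<close>.\<close>

lemma hole_iff:
  assumes t: "t \<in> T"
  shows "t \<in> \<Union>(holes ` D) \<longleftrightarrow> g t \<notin> X \<and> (\<exists>p. parent T p t \<and> g p \<in> X)"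
proof
  assume "t \<in> \<Union>(holes ` D)"
  then obtain S where S: "S \<in> D" "t \<in> holes S" by blast
  have tS: "t \<subset> wheel S" "\<forall>h\<in>holes S. \<not> t \<subset> h" using cheese[OF S(1)] S(2) by blast+
  obtain p where p: "parent T p t"
    using parent_exists[OF T] t T wheels_in[OF S(1)] tS by blast
  have pS: "g p \<in> cheese_set S" using parent_generic_in_cheese S t p tS by blast
  have "g t \<notin> X"
  proof
    assume "g t \<in> X"
    then obtain S' where S': "S' \<in> D" "g t \<in> cheese_set S'" using generic_in_iff by blast
    then have t_in: "t \<subseteq> wheel S'" "\<forall>h\<in>holes S'. \<not> t \<subseteq> h"
      using generic_in_cheese_iff t by blast+
    then have "t \<subset> wheel S'" using wheel_not_hole[OF S'(1) S(1)] S(2) by blast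
    then have "g p \<in> cheese_set S'" using parent_generic_in_cheese[OF S'(1) t p] t_in by blast
    then have "S = S'" using same_cheese S S' pS by blast
    then show False using t_in S by blast
  qed
  then show "g t \<notin> X \<and> (\<exists>p. parent T p t \<and> g p \<in> X)"
    using p pS generic_in_iff S(1) by blast
next
  assume "g t \<notin> X \<and> (\<exists>p. parent T p t \<and> g p \<in> X)"
  then obtain p S where r: "g t \<notin> X" and p: "parent T p t"
    and S: "S \<in> D" "g p \<in> cheese_set S" using generic_in_iff by blast
  have tp: "p \<in> T" "t \<subset> p" using p unfolding parent_def by simp_all
  then have p_in: "p \<subseteq> wheel S" "\<forall>h\<in>holes S. \<not> p \<subseteq> h" using generic_in_cheese_iff S by blast+
  moreover have "g t \<notin> cheese_set S" using r generic_in_iff S(1) by blast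
  ultimately obtain h where h: "h \<in> holes S" "t \<subseteq> h"
    using generic_in_cheese_iff[OF S(1) t] tp by blast
  have "t = h"
  proof (rule ccontr)
    assume "t \<noteq> h"
    moreover have "h \<in> T" using h(1) holes_in[OF S(1)] by blast
    ultimately have "p \<subseteq> h" using p h(2) unfolding parent_def by simp
    then show False using p_in(2) h(1) by blast
  qed
  then show "t \<in> \<Union>(holes ` D)" using h S by blast
qed

lemma wheels_eq: "wheel ` D = {t\<in>T. g t \<in> X \<and> (\<forall>p. parent T p t \<longrightarrow> g p \<notin> X)}" (is "_ = ?W")
proof (rule set_eqI)
  show "t \<in> wheel ` D \<longleftrightarrow> t \<in> ?W" for t
    using wheel_iff[of t] wheels_in by (cases "t \<in> T") auto
qed

lemma all_holes_eq:
  "\<Union>(holes ` D) = {t\<in>T. g t \<notin> X \<and> (\<exists>p. parent T p t \<and> g p \<in> X)}" (is "_ = ?H")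
proof (rule set_eqI)
  show "t \<in> \<Union>(holes ` D) \<longleftrightarrow> t \<in> ?H" for t
    using hole_iff[of t] holes_in by (cases "t \<in> T") auto
qed

text \<open>A hole of \<open>S\<close> containing the wheel of \<open>S'\<close> would strictly
  contain the hole \<open>h\<close>, which incomparability forbids. So the generic point of a wheel
  strictly between would lie in \<open>S\<close>, and the two cheeses would coincide.\<close>

lemma no_wheel_between:
  assumes S: "S \<in> D" "S' \<in> D" and h: "h \<in> holes S" "h \<subset> wheel S'"
  shows "\<not> wheel S' \<subset> wheel S"
proof
  assume less: "wheel S' \<subset> wheel S"
  have "\<forall>k\<in>holes S. \<not> wheel S' \<subseteq> k" using cheese(2)[OF S(1)] h by blast
  then have "g (wheel S') \<in> cheese_set S"
    using generic_in_cheese_iff[OF S(1) wheels_in[OF S(2)]] less by blast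
  then show False using same_cheese generic_wheel_in_cheese S less by blast
qed

text \<open>If \<open>h\<close> is a hole of \<open>S'\<close>, the wheels of \<open>S\<close> and
  \<open>S'\<close> share the subball \<open>h\<close> and are comparable. Neither is strictly
  smaller, so they are equal; their common generic point lies in both cheeses, whence
  \<open>S = S'\<close>.\<close>

lemma holes_eq:
  assumes S: "S \<in> D"
  shows "holes S = {h \<in> \<Union>(holes ` D). h \<subset> wheel S \<and>
    \<not> (\<exists>A\<in>wheel ` D. h \<subset> A \<and> A \<subset> wheel S)}" (is "_ = ?H")
proof
  show "holes S \<subseteq> ?H" using S cheese(1)[OF S] no_wheel_between[OF S] by blast
  show "?H \<subseteq> holes S"
  proof
    fix h assume h: "h \<in> ?H"
    then obtain S' where S': "S' \<in> D" "h \<in> holes S'" by blast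
    have "h \<subset> wheel S'" using cheese(1) S' by blast
    moreover have "h \<in> \<B>" "wheel S \<in> \<B>" "wheel S' \<in> \<B>"
      using holes_in[OF S'(1)] S'(2) wheels_in[OF S] wheels_in[OF S'(1)] T(2) by blast+
    ultimately have "wheel S \<subseteq> wheel S' \<or> wheel S' \<subseteq> wheel S"
      using comparable_if_common_subball[of "wheel S" "wheel S'" h] h by auto
    moreover have "\<not> wheel S \<subset> wheel S'" using no_wheel_between[OF S'(1) S S'(2)] h by blast
    moreover have "\<not> wheel S' \<subset> wheel S" using h S' \<open>h \<subset> wheel S'\<close> by blast
    ultimately have "wheel S = wheel S'" by blast
    then have "S = S'"
      using same_cheese[OF S S'(1)] generic_wheel_in_cheese[OF S]
        generic_wheel_in_cheese[OF S'(1)] by simp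
    then show "h \<in> holes S" using S' by simp
  qed
qed

text \<open>The right-hand side depends on \<open>D\<close> only through its set of wheels and its
  set of all holes, which is what the comparison of two decompositions needs.\<close>

lemma decomposition_eq:
  "D = (\<lambda>A. (A, {h \<in> \<Union>(holes ` D). h \<subset> A \<and> \<not> (\<exists>A'\<in>wheel ` D. h \<subset> A' \<and> A' \<subset> A)})) ` wheel ` D"
  (is "D = ?f ` wheel ` D")
proof -
  have "?f (wheel S) = S" if "S \<in> D" for S
    using holes_eq[OF that] by (metis (no_types, lifting) holes_def wheel_def prod.collapse)
  then have "(\<lambda>S. ?f (wheel S)) ` D = (\<lambda>S. S) ` D" by (rule image_cong[OF refl])
  then show ?thesis by (simp only: image_image image_ident)
qed

end

section \<open>Uniqueness of decompositions, and gluing of cheeses\<close>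

context ball_family
begin

lemma decomposition_unique:
  assumes "unpackable \<B>" "swiss_cheese_decomposition \<B> X D" "swiss_cheese_decomposition \<B> X E"
  shows "D = E"
proof -
  \<comment> \<open>With the wheels and holes of both decompositions in \<open>T\<close>, one choice
    of \<open>g\<close> serves \<open>D\<close> and \<open>E\<close>, and the descriptions of their
    wheels and holes become literally the same sets.\<close>
  define T where "T = wheel ` (D \<union> E) \<union> \<Union>(holes ` (D \<union> E))"
  have T: "finite T" "T \<subseteq> \<B>"
    using assms(2,3) unfolding T_def swiss_cheese_decomposition_def swiss_cheese_def by auto
  have "\<forall>t\<in>T. \<exists>x. \<forall>s\<in>T. x \<in> s \<longleftrightarrow> t \<subseteq> s"
    using generic_point_exists[OF assms(1) T] T(2) by blast
  then obtain g where g: "\<forall>t\<in>T. \<forall>s\<in>T. g t \<in> s \<longleftrightarrow> t \<subseteq> s" by metis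
  interpret D: decomposition_with_generic_points \<B> T g X D
    by unfold_locales (use T g assms in \<open>auto simp: T_def\<close>)
  interpret E: decomposition_with_generic_points \<B> T g X E
    by unfold_locales (use T g assms in \<open>auto simp: T_def\<close>)
  have wheels: "wheel ` D = wheel ` E" using D.wheels_eq E.wheels_eq by simp
  have holes: "\<Union>(holes ` D) = \<Union>(holes ` E)" using D.all_holes_eq E.all_holes_eq by simp
  show ?thesis
    using D.decomposition_eq E.decomposition_eq unfolding wheels holes by simp
qed

text \<open>A swiss cheese decomposition with condition (ii) left out; gluing enforces that
  condition afterwards.\<close>

definition disjoint_cheeses :: "'a set \<Rightarrow> 'a cheese set \<Rightarrow> bool" where
  "disjoint_cheeses X D \<longleftrightarrow> finite D \<and> (\<forall>S\<in>D. swiss_cheese \<B> S) \<and>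
    (\<forall>S\<in>D. \<forall>T\<in>D. S \<noteq> T \<longrightarrow> cheese_set S \<inter> cheese_set T = {}) \<and>
    X = (\<Union>S\<in>D. cheese_set S)"

text \<open>Filling the hole \<open>wheel S\<close> of \<open>T\<close> with \<open>S\<close> leaves
  the holes of \<open>S\<close> in its place. The other holes of \<open>T\<close> are incomparable
  with \<open>wheel S\<close>, hence disjoint from it: they neither cut into \<open>S\<close> nor
  compare with its holes.\<close>

lemma glue_cheeses:
  assumes S: "swiss_cheese \<B> S" and T: "swiss_cheese \<B> T" and hole: "wheel S \<in> holes T"
  defines "M \<equiv> (wheel T, holes T - {wheel S} \<union> holes S)"
  shows "swiss_cheese \<B> M" "cheese_set M = cheese_set S \<union> cheese_set T"
proof -
  have disj: "h \<inter> wheel S = {}" if "h \<in> holes T" "h \<noteq> wheel S" for h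
  proof -
    have "h \<in> \<B>" "wheel S \<in> \<B>" using that(1) T hole unfolding swiss_cheese_def by auto
    moreover have "\<not> h \<subseteq> wheel S" "\<not> wheel S \<subseteq> h"
      using that T hole unfolding swiss_cheese_def by metis+
    ultimately show ?thesis using subset_or_subset_or_disjoint by metis
  qed
  have incomparable: "\<not> h \<subseteq> k \<and> \<not> k \<subseteq> h" if "h \<in> holes T" "h \<noteq> wheel S" "k \<in> holes S" for h k
  proof -
    have "k \<subseteq> wheel S" "h \<noteq> {}" "k \<noteq> {}"
      using that S T nonempty unfolding swiss_cheese_def by auto
    then show ?thesis using disj[OF that(1,2)] by blast
  qed
  show "swiss_cheese \<B> M"
    unfolding swiss_cheese_def
  proof (intro conjI)
    show "wheel M \<in> \<B>" "finite (holes M)" "holes M \<subseteq> \<B>"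
      using S T unfolding swiss_cheese_def M_def wheel_def holes_def by auto
    have "h \<subset> wheel T" if "h \<in> holes S" for h
      using that S T hole unfolding swiss_cheese_def by (metis psubset_trans)
    then show "\<forall>B\<in>holes M. B \<subset> wheel M"
      using T unfolding swiss_cheese_def M_def wheel_def holes_def by (simp add: ball_Un)
    show "\<forall>B\<in>holes M. \<forall>C\<in>holes M. B \<noteq> C \<longrightarrow> \<not> B \<subseteq> C"
      using S T incomparable unfolding swiss_cheese_def M_def wheel_def holes_def
      by (simp add: ball_Un)
  qed
  have "wheel S \<subseteq> wheel T" "\<Union>(holes S) \<subseteq> wheel S"
    using S T hole unfolding swiss_cheese_def by auto
  moreover have "\<Union>(holes T - {wheel S}) \<inter> wheel S = {}" using disj by auto
  moreover have "\<Union>(holes T) = \<Union>(holes T - {wheel S}) \<union> wheel S" using hole by auto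
  moreover have "wheel M = wheel T" "\<Union>(holes M) = \<Union>(holes T - {wheel S}) \<union> \<Union>(holes S)"
    unfolding M_def wheel_def holes_def by auto
  ultimately show "cheese_set M = cheese_set S \<union> cheese_set T"
    unfolding cheese_set_def by auto
qed

text \<open>In a collection of least cardinality no wheel is a hole, since gluing the two cheeses
  involved would give a smaller collection.\<close>

lemma decomposition_if_disjoint_cheeses:
  assumes "disjoint_cheeses X D"
  shows "\<exists>D. swiss_cheese_decomposition \<B> X D"
proof -
  obtain D where D: "disjoint_cheeses X D" and least: "\<And>E. disjoint_cheeses X E \<Longrightarrow> card D \<le> card E"
    using ex_has_least_nat[of "disjoint_cheeses X" D card] assms by blast
  have "wheel S \<notin> holes T" if "S \<in> D" "T \<in> D" for S T
  proof
    assume hole: "wheel S \<in> holes T"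
    have ST: "swiss_cheese \<B> S" "swiss_cheese \<B> T"
      using D that unfolding disjoint_cheeses_def by blast+
    then have "S \<noteq> T" using hole unfolding swiss_cheese_def by blast
    define M where "M = (wheel T, holes T - {wheel S} \<union> holes S)"
    note M = glue_cheeses[OF ST hole, folded M_def]
    let ?E = "insert M (D - {S, T})"
    have "disjoint_cheeses X ?E"
      unfolding disjoint_cheeses_def
    proof (intro conjI)
      show "finite ?E" "\<forall>S\<in>?E. swiss_cheese \<B> S"
        using D M unfolding disjoint_cheeses_def by auto
      have pw: "\<forall>P\<in>D. \<forall>Q\<in>D. P \<noteq> Q \<longrightarrow> cheese_set P \<inter> cheese_set Q = {}"
        using D unfolding disjoint_cheeses_def by blast
      then have "\<forall>P\<in>D - {S, T}. cheese_set P \<inter> cheese_set M = {}"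
        using M(2) that by blast
      then show "\<forall>P\<in>?E. \<forall>Q\<in>?E. P \<noteq> Q \<longrightarrow> cheese_set P \<inter> cheese_set Q = {}"
        using pw by blast
      have "X = (\<Union>S\<in>D. cheese_set S)" using D unfolding disjoint_cheeses_def by blast
      then show "X = (\<Union>S\<in>?E. cheese_set S)" using M(2) that by auto
    qed
    moreover have fin: "finite D" using D unfolding disjoint_cheeses_def by blast
    have "card ?E < card D"
    proof -
      have "card (D - {S, T}) = card D - 2"
        using card_Diff_subset[of "{S, T}" D] \<open>S \<noteq> T\<close> that by simp
      \<comment> \<open>This keeps the truncated subtraction \<open>card D - 2\<close> exact. Two
        cheeses leave and at most one enters.\<close>
      moreover have "card {S, T} \<le> card D" using that fin by (intro card_mono) auto
      moreover have "card {S, T} = 2" using \<open>S \<noteq> T\<close> by simp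
      moreover have "card ?E \<le> Suc (card (D - {S, T}))" by (rule card_insert_le_m1) auto
      ultimately show ?thesis by linarith
    qed
    ultimately show False using least by fastforce
  qed
  then have "swiss_cheese_decomposition \<B> X D"
    using D unfolding disjoint_cheeses_def swiss_cheese_decomposition_def by simp
  then show ?thesis by blast
qed

end

section \<open>Constructible sets as unions of atoms of finitely many balls\<close>

definition union_of_atoms :: "'a set \<Rightarrow> 'a set set \<Rightarrow> 'a set \<Rightarrow> bool" where
  "union_of_atoms U T X \<longleftrightarrow> X \<subseteq> U \<and>
    (\<forall>x\<in>U. \<forall>y\<in>U. (\<forall>t\<in>T. x \<in> t \<longleftrightarrow> y \<in> t) \<longrightarrow> (x \<in> X \<longleftrightarrow> y \<in> X))"

lemma union_of_atomsI:
  assumes "X \<subseteq> U"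
    and "\<And>x y. x \<in> U \<Longrightarrow> y \<in> U \<Longrightarrow> \<forall>t\<in>T. x \<in> t \<longleftrightarrow> y \<in> t \<Longrightarrow> x \<in> X \<longleftrightarrow> y \<in> X"
  shows "union_of_atoms U T X"
  unfolding union_of_atoms_def by (intro conjI ballI impI assms(1)) (rule assms(2))

lemma union_of_atoms_subset: "union_of_atoms U T X \<Longrightarrow> X \<subseteq> U"
  unfolding union_of_atoms_def by (rule conjunct1)

lemma union_of_atomsD:
  assumes "union_of_atoms U T X" "x \<in> U" "y \<in> U" "\<forall>t\<in>T. x \<in> t \<longleftrightarrow> y \<in> t"
  shows "x \<in> X \<longleftrightarrow> y \<in> X"
  using assms(1)[unfolded union_of_atoms_def, THEN conjunct2, rule_format, OF assms(2,3)] assms(4)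
  by blast

text \<open>A larger \<open>T\<close> has finer atoms. This lets the families found for two sets be
  merged.\<close>

lemma union_of_atoms_mono:
  assumes "union_of_atoms U T X" "T \<subseteq> T'"
  shows "union_of_atoms U T' X"
proof (rule union_of_atomsI[OF union_of_atoms_subset[OF assms(1)]])
  fix x y assume xy: "x \<in> U" "y \<in> U" and "\<forall>t\<in>T'. x \<in> t \<longleftrightarrow> y \<in> t"
  then have "\<forall>t\<in>T. x \<in> t \<longleftrightarrow> y \<in> t" using assms(2) by auto
  then show "x \<in> X \<longleftrightarrow> y \<in> X" by (rule union_of_atomsD[OF assms(1) xy])
qed

lemma union_of_atoms_Diff:
  assumes "union_of_atoms U T X"
  shows "union_of_atoms U T (U - X)"
proof (rule union_of_atomsI)
  show "x \<in> U - X \<longleftrightarrow> y \<in> U - X" if "x \<in> U" "y \<in> U" "\<forall>t\<in>T. x \<in> t \<longleftrightarrow> y \<in> t" for x y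
    using union_of_atomsD[OF assms that] that(1,2) by simp
qed (rule Diff_subset)

lemma union_of_atoms_Un:
  assumes "union_of_atoms U T X" "union_of_atoms U T Y"
  shows "union_of_atoms U T (X \<union> Y)"
proof (rule union_of_atomsI)
  show "X \<union> Y \<subseteq> U" using assms[THEN union_of_atoms_subset] by (rule Un_least)
  show "x \<in> X \<union> Y \<longleftrightarrow> y \<in> X \<union> Y" if "x \<in> U" "y \<in> U" "\<forall>t\<in>T. x \<in> t \<longleftrightarrow> y \<in> t" for x y
    using assms[THEN union_of_atomsD, OF that] by simp
qed

lemma union_of_atoms_Int:
  assumes "union_of_atoms U T X" "union_of_atoms U T Y"
  shows "union_of_atoms U T (X \<inter> Y)"
proof (rule union_of_atomsI)
  show "X \<inter> Y \<subseteq> U" using assms(1)[THEN union_of_atoms_subset] by (rule le_infI1)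
  show "x \<in> X \<inter> Y \<longleftrightarrow> y \<in> X \<inter> Y" if "x \<in> U" "y \<in> U" "\<forall>t\<in>T. x \<in> t \<longleftrightarrow> y \<in> t" for x y
    using assms[THEN union_of_atomsD, OF that] by simp
qed

text \<open>Points that lie in the same members of \<open>T\<close> form an atom. A ball
  \<open>B\<close> is a union of atoms of \<open>{B}\<close>, and boolean operations preserve the
  property once the families are merged.\<close>

lemma constructible_union_of_atoms:
  assumes "X \<in> constructible U \<B>" "\<B> \<subseteq> Pow U"
  shows "\<exists>T. finite T \<and> T \<subseteq> \<B> \<and> union_of_atoms U T X"
  using assms(1)
proof induction
  case (ball B)
  then show ?case using assms(2) by (intro exI[of _ "{B}"]) (auto simp: union_of_atoms_def)
next
  case (compl X)
  then obtain T where T: "finite T" "T \<subseteq> \<B>" "union_of_atoms U T X" by blast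
  then show ?case using union_of_atoms_Diff by blast
next
  case (union X Y)
  then obtain T T' where "finite T" "T \<subseteq> \<B>" "union_of_atoms U T X"
    "finite T'" "T' \<subseteq> \<B>" "union_of_atoms U T' Y" by blast
  moreover have "T \<subseteq> T \<union> T'" "T' \<subseteq> T \<union> T'" by auto
  ultimately show ?case using union_of_atoms_Un union_of_atoms_mono finite_UnI Un_least by metis
next
  case (inter X Y)
  then obtain T T' where "finite T" "T \<subseteq> \<B>" "union_of_atoms U T X"
    "finite T'" "T' \<subseteq> \<B>" "union_of_atoms U T' Y" by blast
  moreover have "T \<subseteq> T \<union> T'" "T' \<subseteq> T \<union> T'" by auto
  ultimately show ?case using union_of_atoms_Int union_of_atoms_mono finite_UnI Un_least by metis
qed

section \<open>Existence of decompositions and uniqueness of presentations\<close>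

context ball_family
begin

text \<open>The points whose smallest surrounding member of \<open>T\<close> is \<open>t\<close>
  form the cheese with wheel \<open>t\<close> whose holes \<open>H t\<close> are the maximal members
  of \<open>T\<close> strictly inside \<open>t\<close>. These sets partition the union of
  \<open>T\<close>, and \<open>X\<close> is the union of those it contains.\<close>

lemma disjoint_cheeses_if_union_of_atoms:
  assumes T: "finite T" "T \<subseteq> \<B>" and X: "union_of_atoms (\<Union>T) T X"
  shows "\<exists>D. disjoint_cheeses X D"
proof -
  have "\<exists>H. H \<subseteq> {s\<in>T. s \<subset> t} \<and> \<Union>H = \<Union>{s\<in>T. s \<subset> t} \<and>
      (\<forall>B\<in>H. \<forall>C\<in>H. B \<noteq> C \<longrightarrow> \<not> B \<subseteq> C)" for t
  proof -
    have "finite {s\<in>T. s \<subset> t}" "{s\<in>T. s \<subset> t} \<subseteq> \<B>" using T by auto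
    then obtain M where "M \<subseteq> {s\<in>T. s \<subset> t}" "\<Union>M = \<Union>{s\<in>T. s \<subset> t}"
      "\<forall>B\<in>M. \<forall>C\<in>M. B \<noteq> C \<longrightarrow> \<not> B \<subseteq> C" by (rule maximal_balls)
    then show ?thesis by (intro exI[of _ M] conjI)
  qed
  then obtain H where H: "\<And>t. H t \<subseteq> {s\<in>T. s \<subset> t}" "\<And>t. \<Union>(H t) = \<Union>{s\<in>T. s \<subset> t}"
    "\<And>t. \<forall>B\<in>H t. \<forall>C\<in>H t. B \<noteq> C \<longrightarrow> \<not> B \<subseteq> C" by metis
  define atom where "atom t = t - \<Union>{s\<in>T. s \<subset> t}" for t
  have set_eq: "cheese_set (t, H t) = atom t" for t
    unfolding cheese_set_def wheel_def holes_def atom_def using H(2) by simp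
  have atom_mem: "x \<in> s \<longleftrightarrow> t \<subseteq> s" if "t \<in> T" "s \<in> T" "x \<in> atom t" for x s t
    using comparable_if_common_point[of s t x] that T unfolding atom_def by blast
  have atom_cover: "\<exists>t\<in>T. x \<in> atom t" if "x \<in> \<Union>T" for x
  proof -
    have "finite {t\<in>T. x \<in> t}" "{t\<in>T. x \<in> t} \<noteq> {}" using T that by auto
    then obtain t where "t \<in> {t\<in>T. x \<in> t}" "\<forall>s\<in>{t\<in>T. x \<in> t}. s \<subseteq> t \<longrightarrow> s = t"
      using finite_has_minimal[of "{t\<in>T. x \<in> t}"] by metis
    then show ?thesis unfolding atom_def by blast
  qed
  \<comment> \<open>An atom may be empty; its \<open>t\<close> then belongs to \<open>?W\<close> and
    contributes an empty cheese.\<close>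
  let ?W = "{t\<in>T. atom t \<subseteq> X}"
  have "disjoint_cheeses X ((\<lambda>t. (t, H t)) ` ?W)"
    unfolding disjoint_cheeses_def
  proof (intro conjI)
    show "finite ((\<lambda>t. (t, H t)) ` ?W)" using T by simp
    have "swiss_cheese \<B> (t, H t)" if "t \<in> T" for t
      unfolding swiss_cheese_def wheel_def holes_def
      using H(1)[of t] H(3)[of t] T that finite_subset[of "H t" T] by auto
    then show "\<forall>S\<in>(\<lambda>t. (t, H t)) ` ?W. swiss_cheese \<B> S" by blast
    have "atom s \<inter> atom t = {}" if "s \<in> T" "t \<in> T" "s \<noteq> t" for s t
      using atom_mem that by blast
    then show "\<forall>S\<in>(\<lambda>t. (t, H t)) ` ?W. \<forall>S'\<in>(\<lambda>t. (t, H t)) ` ?W.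
        S \<noteq> S' \<longrightarrow> cheese_set S \<inter> cheese_set S' = {}"
      using set_eq by auto
    have "x \<in> (\<Union>t\<in>?W. atom t)" if "x \<in> X" for x
    proof -
      obtain t where t: "t \<in> T" "x \<in> atom t"
        using atom_cover subsetD[OF union_of_atoms_subset[OF X] \<open>x \<in> X\<close>] by blast
      have "y \<in> X" if "y \<in> atom t" for y
      proof -
        have "x \<in> \<Union>T" "y \<in> \<Union>T" using t that unfolding atom_def by blast+
        moreover have "\<forall>s\<in>T. x \<in> s \<longleftrightarrow> y \<in> s" using atom_mem t that by simp
        ultimately show ?thesis using union_of_atomsD[OF X] \<open>x \<in> X\<close> by metis
      qed
      then show ?thesis using t by blast
    qed
    then have "X = (\<Union>t\<in>?W. atom t)" by blast
    then show "X = (\<Union>S\<in>(\<lambda>t. (t, H t)) ` ?W. cheese_set S)" using set_eq by simp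
  qed
  then show ?thesis by blast
qed

lemma decomposition_exists:
  assumes "X \<in> constructible U \<B>" "\<B> \<subseteq> Pow U" "U \<in> \<B>"
  shows "\<exists>D. swiss_cheese_decomposition \<B> X D"
proof -
  obtain T where T: "finite T" "T \<subseteq> \<B>" "union_of_atoms U T X"
    using constructible_union_of_atoms[OF assms(1,2)] by blast
  \<comment> \<open>Points of \<open>U\<close> outside all members of \<open>T\<close> need a wheel
    too; adjoining the ball \<open>U\<close> provides it.\<close>
  have "\<Union>(insert U T) = U" using T(2) assms(2) by blast
  moreover have "union_of_atoms U (insert U T) X" using T(3) union_of_atoms_mono by blast
  ultimately obtain D where "disjoint_cheeses X D"
    using disjoint_cheeses_if_union_of_atoms[of "insert U T" X] T(1,2) assms(3) by auto
  then show ?thesis by (rule decomposition_if_disjoint_cheeses)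
qed

text \<open>A single cheese is a decomposition of its own set, since its holes are proper subsets of
  its wheel. So uniqueness of decompositions applies.\<close>

lemma presentation_unique:
  assumes "unpackable \<B>" "swiss_cheese \<B> S" "swiss_cheese \<B> S'" "cheese_set S = cheese_set S'"
  shows "S = S'"
proof -
  have "swiss_cheese_decomposition \<B> (cheese_set S) {P}"
    if "swiss_cheese \<B> P" "cheese_set P = cheese_set S" for P
    using that unfolding swiss_cheese_decomposition_def swiss_cheese_def by auto
  then show ?thesis using decomposition_unique[OF assms(1)] assms(2-4) by (metis singleton_inject)
qed

end

theorem theorem2p2:
  fixes U :: "'a set" and \<B> :: "'a set set"
  assumes "\<B> \<subseteq> Pow U - {{}}"
    and "directed_family \<B>"
    and "U \<in> \<B>"
  shows "(unpackable \<B> \<longleftrightarrow>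
           (\<forall>A\<in>\<B>. \<forall>F. finite F \<and> F \<subseteq> \<B> \<and> A \<subseteq> \<Union>F \<longrightarrow> (\<exists>B\<in>F. A \<subseteq> B)))
    \<and> (unpackable \<B> \<longleftrightarrow>
           (\<forall>A1 H1 A2 H2.
              swiss_cheese \<B> (A1, H1) \<and> swiss_cheese \<B> (A2, H2) \<and>
              cheese_set (A1, H1) = cheese_set (A2, H2) \<and>
              pairwise disjnt H1 \<and> pairwise disjnt H2
              \<longrightarrow> A1 = A2 \<and> H1 = H2))
    \<and> (unpackable \<B> \<longleftrightarrow>
           (\<forall>X\<in>constructible U \<B>. \<exists>!D. swiss_cheese_decomposition \<B> X D))"
  (is "(_ \<longleftrightarrow> ?cover) \<and> (_ \<longleftrightarrow> ?presentation) \<and> (_ \<longleftrightarrow> ?decomposition)")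
proof -
  interpret ball_family \<B> by unfold_locales (use assms in auto)
  have "?presentation" if "unpackable \<B>"
    using presentation_unique[OF that] by blast
  moreover have "unpackable \<B>" if ?presentation
    using two_presentations_if_packable that by metis
  moreover have "?decomposition" if "unpackable \<B>"
    using decomposition_exists[of _ U] decomposition_unique[OF that] assms by blast
  \<comment> \<open>A packed ball is constructible, so its two decompositions contradict
    uniqueness.\<close>
  moreover have "unpackable \<B>" if ?decomposition
    using two_decompositions_if_packable that constructible.ball by metis
  ultimately show ?thesis using unpackable_iff_cover by argo
qed

end
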